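(* Let $1\le p<\infty$. Let $\mu$ be a probability measure on $\mathbb{R}^d$ with a density $\rho$ with respect to Lebesgue measure and with compact support. Let $\tilde\mu_n$ be a sequence of probability measures, absolutely continuous with respect to $\mu$, such that $$\frac{d\tilde\mu_n}{d\mu}\to1\quad\text{uniformly on the support of }\mu .$$ Assume $f_n\to f$ in $L^p(\mu)$ as $n\to\infty$. Then $(\tilde\mu_n,f_n)\to(\mu,f)$ in $TL^p$ as $n\to\infty$.
   Context: $TL^p$ is the set of pairs $(\nu,g)$ with $\nu$ a compactly supported Borel probability measure (here, on a fixed compact set containing the support of $\mu$) and $g\in L^p(\nu)$, with metric $$d_{TL^p}((\nu,g),(\nu',g'))=\inf_\pi\Big(\int |x-y|^p+|g(x)-g'(y)|^p\,d\pi(x,y)\Big)^{1/p},$$ the infimum being over couplings $\pi$ of $\nu$ and $\nu'$. (Since $d\tilde\mu_n/d\mu$ is bounded for all large $n$, $f_n\in L^p(\tilde\mu_n)$ for all large $n$.) *)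

theory Defs
  imports "HOL-Probability.Probability"
begin

definition measure_support :: "'a::topological_space measure \<Rightarrow> 'a set" where
  "measure_support M = {x. \<forall>U. open U \<and> x \<in> U \<longrightarrow> 0 < emeasure M U}"

text \<open>Elements of \<open>L\<^sup>p\<close> are represented by measurable functions rather than by their a.e. classes.
  Below, \<open>x powr p\<close> is only used with \<open>x \<ge> 0\<close> and \<open>p \<ge> 1\<close>, where \<open>0 powr p = 0\<close>.\<close>

definition Lp_space :: "real \<Rightarrow> 'a measure \<Rightarrow> ('a \<Rightarrow> real) set" where
  "Lp_space p M = {g \<in> borel_measurable M. integrable M (\<lambda>x. \<bar>g x\<bar> powr p)}"

definition Lp_norm :: "real \<Rightarrow> 'a measure \<Rightarrow> ('a \<Rightarrow> real) \<Rightarrow> real" where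
  "Lp_norm p M g = (\<integral>x. \<bar>g x\<bar> powr p \<partial>M) powr (1 / p)"

definition Lp_tendsto ::
    "real \<Rightarrow> 'a measure \<Rightarrow> (nat \<Rightarrow> 'a \<Rightarrow> real) \<Rightarrow> ('a \<Rightarrow> real) \<Rightarrow> bool" where
  "Lp_tendsto p M f g \<longleftrightarrow>
     (\<forall>n. f n \<in> Lp_space p M) \<and> g \<in> Lp_space p M \<and>
     (\<lambda>n. Lp_norm p M (\<lambda>x. f n x - g x)) \<longlonglongrightarrow> 0"

definition couplings ::
    "'a::topological_space measure \<Rightarrow> 'b::topological_space measure \<Rightarrow> ('a \<times> 'b) measure set" where
  "couplings M N = {\<pi>. sets \<pi> = sets (borel \<Otimes>\<^sub>M borel) \<and>
     distr \<pi> borel fst = M \<and> distr \<pi> borel snd = N}"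

definition TLp_space ::
    "real \<Rightarrow> 'a::euclidean_space set \<Rightarrow> ('a measure \<times> ('a \<Rightarrow> real)) set" where
  "TLp_space p K = {(\<nu>, g). prob_space \<nu> \<and> sets \<nu> = sets borel \<and>
     measure_support \<nu> \<subseteq> K \<and> g \<in> Lp_space p \<nu>}"

definition ennreal_root :: "real \<Rightarrow> ennreal \<Rightarrow> ennreal" where
  "ennreal_root p a = (if a = \<infinity> then \<infinity> else ennreal (enn2real a powr (1 / p)))"

text \<open>The distance is \<open>ennreal\<close>-valued so that it is meaningful for arbitrary pairs; on
  \<open>TLp_space p K\<close> with \<open>K\<close> compact it is finite. As functions are not identified a.e., it is
  a pseudometric there.\<close>

definition TLp_dist ::
    "real \<Rightarrow> 'a::euclidean_space measure \<times> ('a \<Rightarrow> real) \<Rightarrow> 'a measure \<times> ('a \<Rightarrow> real) \<Rightarrow> ennreal" where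
  "TLp_dist p = (\<lambda>(\<nu>, g) (\<nu>', g'). INF \<pi>\<in>couplings \<nu> \<nu>'. ennreal_root p
     (\<integral>\<^sup>+(x, y). ennreal (norm (x - y) powr p + \<bar>g x - g' y\<bar> powr p) \<partial>\<pi>))"

text \<open>The sequence is only required to lie in the space from some index on.\<close>

definition TLp_tendsto ::
    "real \<Rightarrow> 'a::euclidean_space set \<Rightarrow> (nat \<Rightarrow> 'a measure \<times> ('a \<Rightarrow> real)) \<Rightarrow>
      'a measure \<times> ('a \<Rightarrow> real) \<Rightarrow> bool" where
  "TLp_tendsto p K X Y \<longleftrightarrow>
     (\<forall>\<^sub>F n in sequentially. X n \<in> TLp_space p K) \<and> Y \<in> TLp_space p K \<and>
     (\<lambda>n. TLp_dist p (X n) Y) \<longlonglongrightarrow> 0"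

text \<open>The Radon-Nikodym derivative is determined only a.e.; \<open>h\<close> is a finite-valued version of it.\<close>

definition RN_version :: "'a measure \<Rightarrow> 'a measure \<Rightarrow> ('a \<Rightarrow> real) \<Rightarrow> bool" where
  "RN_version M N h \<longleftrightarrow> h \<in> borel_measurable M \<and> (\<forall>x. 0 \<le> h x) \<and>
     (AE x in M. RN_deriv M N x = ennreal (h x))"

end

theory Submission
  imports Defs
begin

text \<open>If \<open>\<bar>h - 1\<bar> \<le> \<epsilon>\<close> almost everywhere, then \<open>h\<mu> = (1 - \<epsilon>)\<mu> + w\<mu>\<close> with \<open>0 \<le> w \<le> 2\<epsilon>\<close> and \<open>w\<mu>\<close> of
  mass \<open>\<epsilon>\<close>. Leaving the part \<open>(1 - \<epsilon>)\<mu>\<close> in place and spreading the rest independently, as \<open>w\<mu> \<otimes> \<mu>\<close>,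
  gives a coupling of \<open>h\<mu>\<close> and \<open>\<mu>\<close>. The diagonal part costs at most \<open>\<integral>\<bar>f\<^sub>n - g\<bar>\<^sup>p d\<mu>\<close>, and the
  remaining part is \<open>O(\<epsilon>)\<close> because \<open>\<mu>\<close> is carried by a bounded set and \<open>f\<^sub>n\<close> is bounded in \<open>L\<^sup>p(\<mu>)\<close>.\<close>

section \<open>A power inequality and supports of Borel measures\<close>

lemma powr_add_le:
  fixes a b p :: real
  assumes "0 \<le> a" "0 \<le> b" "0 \<le> p"
  shows "(a + b) powr p \<le> 2 powr p * (a powr p + b powr p)"
proof -
  have "(a + b) powr p \<le> (2 * max a b) powr p"
    using assms by (intro powr_mono2) auto
  also have "\<dots> = 2 powr p * max a b powr p"
    using assms by (simp add: powr_mult)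
  also have "max a b powr p \<le> a powr p + b powr p"
    by (auto simp: max_def)
  finally show ?thesis by simp
qed

text \<open>Second countability is the reason: every point off the support lies in a null member of
  a countable basis, so countably many null sets cover the complement.\<close>

lemma AE_measure_support:
  fixes M :: "'a::second_countable_topology measure"
  assumes M: "sets M = sets borel"
  shows "AE x in M. x \<in> measure_support M"
proof -
  obtain B :: "'a set set" where B: "countable B" "topological_basis B"
    using ex_countable_basis by blast
  let ?N = "\<Union>{U\<in>B. emeasure M U = 0}"
  have "U \<in> sets M" if "U \<in> B" for U
    using that B M by (simp add: topological_basis_open)
  then have "?N \<in> null_sets M"
    using B(1) by (intro null_sets_UN'[where N="\<lambda>U. U", simplified]) auto
  moreover have "x \<in> ?N" if "x \<notin> measure_support M" for x
  proof -
    have "\<exists>U. open U \<and> x \<in> U \<and> \<not> 0 < emeasure M U"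
      using that by (auto simp: measure_support_def)
    then obtain U where U: "open U" "x \<in> U" "emeasure M U = 0"
      by auto
    then obtain V where "V \<in> B" "x \<in> V" "V \<subseteq> U"
      using B(2) topological_basisE by metis
    moreover have "emeasure M V \<le> emeasure M U"
      using U \<open>V \<subseteq> U\<close> M by (intro emeasure_mono) auto
    ultimately show ?thesis using U by auto
  qed
  ultimately show ?thesis
    by (intro AE_I[where N="?N"]) (auto simp: null_sets_def)
qed

text \<open>Open sets that are null for \<open>M\<close> remain null for \<open>N\<close>. In the
  theorem this keeps the support of every \<open>\<mu>t n\<close> inside \<open>K\<close>.\<close>

lemma measure_support_absolutely_continuous:
  assumes "absolutely_continuous M N" "sets M = sets borel"
  shows "measure_support N \<subseteq> measure_support M"
proof -
  have "emeasure N U = 0" if "open U" "emeasure M U = 0" for U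
    using that assms by (auto simp: absolutely_continuous_def null_sets_def)
  then show ?thesis
    by (auto simp: measure_support_def zero_less_iff_neq_zero)
qed

section \<open>Coupling a measure with a density against it\<close>

text \<open>This is \<open>c \<Delta> + (wM) \<otimes> M\<close>; the boolean coordinate selects the summand,
  \<open>\<Delta>\<close> being the image of \<open>M\<close> on the diagonal.\<close>

definition split_coupling ::
    "ennreal \<Rightarrow> ('a::topological_space \<Rightarrow> ennreal) \<Rightarrow> 'a measure \<Rightarrow> ('a \<times> 'a) measure" where
  "split_coupling c w M =
     distr (density (M \<Otimes>\<^sub>M (M \<Otimes>\<^sub>M count_space (UNIV :: bool set)))
       (\<lambda>(x, y, b). if b then c else w x))
     (borel \<Otimes>\<^sub>M borel) (\<lambda>(x, y, b). (x, if b then x else y))"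

text \<open>Fubini with the boolean innermost: summing over it separates the two summands, and the
  \<open>y\<close> that the diagonal branch ignores integrates to 1. The formula serves both for the
  marginals and for the transport cost.\<close>

lemma nn_integral_split_coupling:
  fixes M :: "'a::topological_space measure"
  assumes "prob_space M" and M[measurable_cong]: "sets M = sets borel"
    and [measurable]: "w \<in> borel_measurable borel"
    and [measurable]: "\<phi> \<in> borel_measurable (borel \<Otimes>\<^sub>M borel)"
  shows "(\<integral>\<^sup>+z. \<phi> z \<partial>split_coupling c w M) =
    c * (\<integral>\<^sup>+x. \<phi> (x, x) \<partial>M) + (\<integral>\<^sup>+x. w x * (\<integral>\<^sup>+y. \<phi> (x, y) \<partial>M) \<partial>M)"
proof -
  interpret prob_space M by fact
  let ?B = "count_space (UNIV :: bool set)"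
  interpret B: sigma_finite_measure ?B
    by (simp add: sigma_finite_measure_count_space_finite)
  interpret P: pair_sigma_finite M ?B ..
  have [measurable]: "(\<lambda>x. \<phi> (x, x)) \<in> borel_measurable M"
    by measurable
  have "(\<integral>\<^sup>+z. \<phi> z \<partial>split_coupling c w M) =
    (\<integral>\<^sup>+(x, y, b). (if b then c else w x) * \<phi> (x, if b then x else y) \<partial>(M \<Otimes>\<^sub>M (M \<Otimes>\<^sub>M ?B)))"
    unfolding split_coupling_def
    by (subst nn_integral_distr, measurable, subst nn_integral_density, measurable)
      (simp add: case_prod_unfold)
  also have "\<dots> = (\<integral>\<^sup>+x. \<integral>\<^sup>+y. (\<integral>\<^sup>+b. (if b then c else w x) * \<phi> (x, if b then x else y) \<partial>?B) \<partial>M \<partial>M)"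
    by (simp add: sigma_finite_measure.nn_integral_fst[OF P.sigma_finite_measure_axioms, symmetric]
        B.nn_integral_fst[symmetric])
  also have "\<dots> = (\<integral>\<^sup>+x. \<integral>\<^sup>+y. c * \<phi> (x, x) + w x * \<phi> (x, y) \<partial>M \<partial>M)"
    by (simp add: nn_integral_count_space_finite UNIV_bool add.commute)
  also have "\<dots> = (\<integral>\<^sup>+x. c * \<phi> (x, x) + w x * (\<integral>\<^sup>+y. \<phi> (x, y) \<partial>M) \<partial>M)"
    by (intro nn_integral_cong)
      (simp add: nn_integral_add nn_integral_cmult emeasure_space_1)
  also have "\<dots> = c * (\<integral>\<^sup>+x. \<phi> (x, x) \<partial>M) + (\<integral>\<^sup>+x. w x * (\<integral>\<^sup>+y. \<phi> (x, y) \<partial>M) \<partial>M)"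
    by (simp add: nn_integral_add nn_integral_cmult)
  finally show ?thesis .
qed

text \<open>In the first marginal the independent \<open>y\<close> contributes total mass 1, which
  leaves the density \<open>c + w\<close>. The second is \<open>M\<close> scaled by \<open>c\<close>
  plus the mass of \<open>w\<close>, hence the normalisation of that sum to 1.\<close>

lemma split_coupling_in_couplings:
  fixes M :: "'a::topological_space measure"
  assumes "prob_space M" and M[measurable_cong]: "sets M = sets borel"
    and [measurable]: "w \<in> borel_measurable borel"
    and mass: "c + (\<integral>\<^sup>+x. w x \<partial>M) = 1"
  shows "split_coupling c w M \<in> couplings (density M (\<lambda>x. c + w x)) M"
proof -
  interpret prob_space M by fact
  let ?\<pi> = "split_coupling c w M"
  have sets[measurable_cong]: "sets ?\<pi> = sets (borel \<Otimes>\<^sub>M borel)"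
    by (simp add: split_coupling_def)
  \<comment> \<open>A general map \<open>q\<close> treats both projections at once.\<close>
  have eq: "emeasure ?\<pi> (q -` A \<inter> space ?\<pi>) =
      c * (\<integral>\<^sup>+x. indicator A (q (x, x)) \<partial>M) + (\<integral>\<^sup>+x. w x * (\<integral>\<^sup>+y. indicator A (q (x, y)) \<partial>M) \<partial>M)"
    if [measurable]: "A \<in> sets borel" "q \<in> borel \<Otimes>\<^sub>M borel \<rightarrow>\<^sub>M borel" for A and q :: "'a \<times> 'a \<Rightarrow> 'a"
  proof -
    have "emeasure ?\<pi> (q -` A \<inter> space ?\<pi>) = (\<integral>\<^sup>+z. indicator (q -` A \<inter> space ?\<pi>) z \<partial>?\<pi>)"
      by (subst nn_integral_indicator) measurable
    also have "\<dots> = (\<integral>\<^sup>+z. indicator A (q z) \<partial>?\<pi>)"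
      by (intro nn_integral_cong) (auto split: split_indicator)
    also have "\<dots> = c * (\<integral>\<^sup>+x. indicator A (q (x, x)) \<partial>M) + (\<integral>\<^sup>+x. w x * (\<integral>\<^sup>+y. indicator A (q (x, y)) \<partial>M) \<partial>M)"
      using assms by (subst nn_integral_split_coupling) auto
    finally show ?thesis .
  qed
  have "distr ?\<pi> borel fst = density M (\<lambda>x. c + w x)"
  proof (rule measure_eqI)
    fix A assume "A \<in> sets (distr ?\<pi> borel fst)"
    then have [measurable]: "A \<in> sets borel" by simp
    show "emeasure (distr ?\<pi> borel fst) A = emeasure (density M (\<lambda>x. c + w x)) A"
      by (simp add: emeasure_distr eq emeasure_space_1 emeasure_density M distrib_right nn_integral_add nn_integral_cmult)
  qed (simp add: M)
  moreover have "distr ?\<pi> borel snd = M"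
  proof (rule measure_eqI)
    fix A assume "A \<in> sets (distr ?\<pi> borel snd)"
    then have [measurable]: "A \<in> sets borel" by simp
    have "emeasure (distr ?\<pi> borel snd) A = (c + (\<integral>\<^sup>+x. w x \<partial>M)) * emeasure M A"
      by (simp add: emeasure_distr eq M distrib_right nn_integral_multc)
    then show "emeasure (distr ?\<pi> borel snd) A = emeasure M A"
      by (simp add: mass)
  qed (simp add: M)
  ultimately show ?thesis using sets by (simp add: couplings_def)
qed

section \<open>Transport cost of the coupling\<close>

lemma ennreal_root_mono:
  assumes "a \<le> b" "0 < p"
  shows "ennreal_root p a \<le> ennreal_root p b"
proof (cases "b = \<infinity>")
  case False
  then have "a \<noteq> \<infinity>" using assms(1) by (auto simp: top_unique)
  moreover have "enn2real a \<le> enn2real b"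
    using assms(1) False by (intro enn2real_mono) (auto simp: less_top)
  ultimately show ?thesis
    using assms(2) False by (auto simp: ennreal_root_def intro!: ennreal_leI powr_mono2)
qed (simp add: ennreal_root_def)

text \<open>The infimum is tested on \<open>split_coupling\<close> with \<open>c = 1 - e\<close>.
  The first integral comes from the diagonal, where nothing is displaced; the term with the factor
  \<open>e\<close> bounds the independent part.\<close>

lemma TLp_dist_density_le:
  fixes M :: "'a::euclidean_space measure"
  assumes "prob_space M" and M[measurable_cong]: "sets M = sets borel" and p: "1 \<le> p"
    and N: "prob_space (density M (\<lambda>x. ennreal (h x)))"
    and [measurable]: "h \<in> borel_measurable borel" "f \<in> borel_measurable borel" "g \<in> borel_measurable borel"
    and e: "0 < e" "e \<le> 1" and h: "AE x in M. \<bar>h x - 1\<bar> \<le> e"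
  shows "TLp_dist p (density M (\<lambda>x. ennreal (h x)), f) (M, g) \<le> ennreal_root p
    ((\<integral>\<^sup>+x. ennreal (\<bar>f x - g x\<bar> powr p) \<partial>M) + ennreal (2 * e * 2 powr p) *
      ((\<integral>\<^sup>+x. ennreal (norm x powr p + \<bar>f x\<bar> powr p) \<partial>M) +
       (\<integral>\<^sup>+x. ennreal (norm x powr p + \<bar>g x\<bar> powr p) \<partial>M)))"
proof -
  interpret prob_space M by fact
  \<comment> \<open>\<open>ennreal\<close> truncates negative values to 0, so \<open>w\<close> is a
    valid density even on the null set where \<open>h x < 1 - e\<close>; the decomposition of
    \<open>h\<close> then holds almost everywhere.\<close>
  define w where "w x = ennreal (h x - (1 - e))" for x
  have [measurable]: "w \<in> borel_measurable borel" by (simp add: w_def[abs_def])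
  have ae: "AE x in M. ennreal (h x) = ennreal (1 - e) + w x"
    using h
  proof eventually_elim
    case (elim x)
    then show ?case using e by (simp add: w_def flip: ennreal_plus)
  qed
  have dens: "density M (\<lambda>x. ennreal (h x)) = density M (\<lambda>x. ennreal (1 - e) + w x)"
    using ae by (intro density_cong) measurable
  \<comment> \<open>Integrating the decomposition of \<open>h\<close>, whose total mass is 1, fixes
    the mass of \<open>w\<close>. The additive form avoids subtraction in
    \<open>ennreal\<close>.\<close>
  have mass: "ennreal (1 - e) + (\<integral>\<^sup>+x. w x \<partial>M) = 1"
  proof -
    have "1 = emeasure (density M (\<lambda>x. ennreal (h x))) (space M)"
      using prob_space.emeasure_space_1[OF N] by simp
    also have "\<dots> = (\<integral>\<^sup>+x. ennreal (1 - e) + w x \<partial>M)"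
      unfolding dens by (subst emeasure_density) (auto intro!: nn_integral_cong)
    also have "\<dots> = ennreal (1 - e) + (\<integral>\<^sup>+x. w x \<partial>M)"
      by (simp add: nn_integral_add emeasure_space_1)
    finally show ?thesis by simp
  qed
  let ?\<pi> = "split_coupling (ennreal (1 - e)) w M"
  let ?c = "\<lambda>(x, y). ennreal (norm (x - y) powr p + \<bar>f x - g y\<bar> powr p)"
  let ?F = "\<lambda>x. ennreal (norm x powr p + \<bar>f x\<bar> powr p)"
  let ?G = "\<lambda>x. ennreal (norm x powr p + \<bar>g x\<bar> powr p)"
  have \<pi>: "?\<pi> \<in> couplings (density M (\<lambda>x. ennreal (h x))) M"
    unfolding dens using assms mass by (intro split_coupling_in_couplings) auto
  \<comment> \<open>Separating \<open>x\<close> from \<open>y\<close> turns the double integral of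
    the independent part into a sum of two single ones.\<close>
  have pw: "?c (x, y) \<le> ennreal (2 powr p) * (?F x + ?G y)" for x y
  proof -
    have "norm (x - y) powr p \<le> (norm x + norm y) powr p"
      using p by (intro powr_mono2 norm_triangle_ineq4) auto
    also have "\<dots> \<le> 2 powr p * (norm x powr p + norm y powr p)"
      using p by (intro powr_add_le) auto
    finally have 1: "norm (x - y) powr p \<le> 2 powr p * (norm x powr p + norm y powr p)" .
    have "\<bar>f x - g y\<bar> powr p \<le> (\<bar>f x\<bar> + \<bar>g y\<bar>) powr p"
      using p by (intro powr_mono2) auto
    also have "\<dots> \<le> 2 powr p * (\<bar>f x\<bar> powr p + \<bar>g y\<bar> powr p)"
      using p by (intro powr_add_le) auto
    finally have "norm (x - y) powr p + \<bar>f x - g y\<bar> powr p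
        \<le> 2 powr p * ((norm x powr p + \<bar>f x\<bar> powr p) + (norm y powr p + \<bar>g y\<bar> powr p))"
      using 1 by (simp add: algebra_simps)
    then show ?thesis
      by (simp add: ennreal_leI flip: ennreal_plus ennreal_mult)
  qed
  have "(\<integral>\<^sup>+z. ?c z \<partial>?\<pi>) = ennreal (1 - e) * (\<integral>\<^sup>+x. ?c (x, x) \<partial>M) + (\<integral>\<^sup>+x. w x * (\<integral>\<^sup>+y. ?c (x, y) \<partial>M) \<partial>M)"
    using assms by (intro nn_integral_split_coupling) auto
  \<comment> \<open>The diagonal weight \<open>1 - e\<close> is relaxed to 1, and
    \<open>h x \<le> 1 + e\<close> gives \<open>w x \<le> 2 * e\<close>.\<close>
  also have "\<dots> \<le> 1 * (\<integral>\<^sup>+x. ennreal (\<bar>f x - g x\<bar> powr p) \<partial>M) +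
      (\<integral>\<^sup>+x. ennreal (2 * e) * (\<integral>\<^sup>+y. ennreal (2 powr p) * (?F x + ?G y) \<partial>M) \<partial>M)"
  proof (intro add_mono mult_mono nn_integral_mono_AE)
    show "AE x in M. w x * (\<integral>\<^sup>+y. ?c (x, y) \<partial>M)
        \<le> ennreal (2 * e) * (\<integral>\<^sup>+y. ennreal (2 powr p) * (?F x + ?G y) \<partial>M)"
      using h
    proof eventually_elim
      case (elim x)
      then have "w x \<le> ennreal (2 * e)" by (auto simp: w_def intro!: ennreal_leI)
      then show ?case by (intro mult_mono nn_integral_mono pw) auto
    qed
  qed (use e in auto)
  also have "\<dots> = (\<integral>\<^sup>+x. ennreal (\<bar>f x - g x\<bar> powr p) \<partial>M) +
      ennreal (2 * e * 2 powr p) * ((\<integral>\<^sup>+x. ?F x \<partial>M) + (\<integral>\<^sup>+x. ?G x \<partial>M))"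
    using e by (simp add: nn_integral_cmult nn_integral_add emeasure_space_1 ennreal_mult mult.assoc del: ennreal_plus)
  finally have "ennreal_root p (\<integral>\<^sup>+z. ?c z \<partial>?\<pi>) \<le> ennreal_root p ((\<integral>\<^sup>+x. ennreal (\<bar>f x - g x\<bar> powr p) \<partial>M) +
      ennreal (2 * e * 2 powr p) * ((\<integral>\<^sup>+x. ?F x \<partial>M) + (\<integral>\<^sup>+x. ?G x \<partial>M)))"
    using p by (intro ennreal_root_mono) auto
  then show ?thesis
    unfolding TLp_dist_def prod.case by (intro INF_lower2[OF \<pi>])
qed

section \<open>Convergence of the pairs in \<open>TL^p\<close>\<close>

theorem lemma3p2:
  fixes p :: real
    and \<mu> :: "(real ^ 'd) measure"
    and \<rho> :: "real ^ 'd \<Rightarrow> real"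
    and \<mu>t :: "nat \<Rightarrow> (real ^ 'd) measure"
    and h :: "nat \<Rightarrow> real ^ 'd \<Rightarrow> real"
    and f :: "nat \<Rightarrow> real ^ 'd \<Rightarrow> real"
    and g :: "real ^ 'd \<Rightarrow> real"
    and K :: "(real ^ 'd) set"
  assumes "1 \<le> p"
    and "\<rho> \<in> borel_measurable borel" and "\<And>x. 0 \<le> \<rho> x"
    and "\<mu> = density lborel (\<lambda>x. ennreal (\<rho> x))"
    and "prob_space \<mu>"
    and "compact (measure_support \<mu>)"
    and "\<And>n. sets (\<mu>t n) = sets borel"
    and "\<And>n. prob_space (\<mu>t n)"
    and "\<And>n. absolutely_continuous \<mu> (\<mu>t n)"
    and "\<And>n. RN_version \<mu> (\<mu>t n) (h n)"
    and "uniform_limit (measure_support \<mu>) h (\<lambda>_. 1) sequentially"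
    and "Lp_tendsto p \<mu> f g"
    and "compact K" and "measure_support \<mu> \<subseteq> K"
  shows "TLp_tendsto p K (\<lambda>n. (\<mu>t n, f n)) (\<mu>, g)"
proof -
  let ?S = "measure_support \<mu>"
  interpret prob_space \<mu> by fact
  have M[measurable_cong]: "sets \<mu> = sets borel" using assms(4) by simp
  have supp: "AE x in \<mu>. x \<in> ?S" by (rule AE_measure_support[OF M])
  obtain R where R: "\<And>x. x \<in> ?S \<Longrightarrow> norm x \<le> R"
    using compact_imp_bounded[OF assms(6)] by (auto simp: bounded_iff)
  have hm[measurable]: "h n \<in> borel_measurable borel" for n
    using assms(10)[of n] M by (simp add: RN_version_def cong: measurable_cong_sets)
  have h0: "0 \<le> h n x" for n x using assms(10)[of n] by (simp add: RN_version_def)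
  have dens: "\<mu>t n = density \<mu> (\<lambda>x. ennreal (h n x))" for n
  proof -
    have "density \<mu> (RN_deriv \<mu> (\<mu>t n)) = \<mu>t n"
      using assms(7,9) M by (intro density_RN_deriv) auto
    moreover have "density \<mu> (RN_deriv \<mu> (\<mu>t n)) = density \<mu> (\<lambda>x. ennreal (h n x))"
      using assms(10)[of n] by (intro density_cong) (auto simp: RN_version_def)
    ultimately show ?thesis by simp
  qed
  have fL: "f n \<in> Lp_space p \<mu>" for n
    using assms(12) by (simp add: Lp_tendsto_def)
  have gL: "g \<in> Lp_space p \<mu>"
    and lim: "(\<lambda>n. Lp_norm p \<mu> (\<lambda>x. f n x - g x)) \<longlonglongrightarrow> 0"
    using assms(12) by (auto simp: Lp_tendsto_def)
  have f_meas[measurable]: "f n \<in> borel_measurable borel" for n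
    using fL[of n] M by (simp add: Lp_space_def cong: measurable_cong_sets)
  have gm[measurable]: "g \<in> borel_measurable borel"
    using gL M by (simp add: Lp_space_def cong: measurable_cong_sets)
  have fi: "integrable \<mu> (\<lambda>x. \<bar>f n x\<bar> powr p)" for n using fL by (simp add: Lp_space_def)
  have gi: "integrable \<mu> (\<lambda>x. \<bar>g x\<bar> powr p)" using gL by (simp add: Lp_space_def)
  \<comment> \<open>Compactness of the support enters here: the norm is bounded by \<open>R\<close>
    almost everywhere.\<close>
  have ni: "integrable \<mu> (\<lambda>x. norm x powr p)"
    using supp R assms(1)
    by (intro integrable_const_bound[where B="R powr p"]) (auto elim!: eventually_mono intro!: powr_mono2)
  have di: "integrable \<mu> (\<lambda>x. \<bar>f n x - g x\<bar> powr p)" for n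
  proof (rule Bochner_Integration.integrable_bound)
    show "integrable \<mu> (\<lambda>x. 2 powr p * (\<bar>f n x\<bar> powr p + \<bar>g x\<bar> powr p))"
      using fi gi by auto
    have "\<bar>f n x - g x\<bar> powr p \<le> 2 powr p * (\<bar>f n x\<bar> powr p + \<bar>g x\<bar> powr p)" for x
      using assms(1) by (intro order_trans[OF powr_mono2 powr_add_le]) auto
    then show "AE x in \<mu>. norm (\<bar>f n x - g x\<bar> powr p) \<le> norm (2 powr p * (\<bar>f n x\<bar> powr p + \<bar>g x\<bar> powr p))"
      by (auto intro!: AE_I2)
  qed measurable
  define D where "D n = (\<integral>x. \<bar>f n x - g x\<bar> powr p \<partial>\<mu>)" for n
  define A where "A = (\<integral>x. norm x powr p \<partial>\<mu>)"
  define G where "G = (\<integral>x. \<bar>g x\<bar> powr p \<partial>\<mu>)"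
  have nonneg: "0 \<le> D n" "0 \<le> A" "0 \<le> G" for n
    by (auto simp: D_def A_def G_def intro!: integral_nonneg_AE)
  have Dlim: "D \<longlonglongrightarrow> 0"
  proof -
    \<comment> \<open>The base tends to 0, so continuity of \<open>powr\<close> at this point rests
      on \<open>p\<close> being positive and the base nonnegative.\<close>
    have "(\<lambda>n. (D n powr (1 / p)) powr p) \<longlonglongrightarrow> 0 powr p"
      using lim assms(1) by (intro tendsto_powr') (auto simp: Lp_norm_def D_def)
    then show ?thesis using assms(1) nonneg by (simp add: powr_powr)
  qed
  \<comment> \<open>Bounds the \<open>p\<close>-th moments of \<open>f n\<close> independently of
    \<open>n\<close> once \<open>D n \<le> 1\<close>.\<close>
  have F: "(\<integral>x. \<bar>f n x\<bar> powr p \<partial>\<mu>) \<le> 2 powr p * (D n + G)" for n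
  proof -
    have "(\<integral>x. \<bar>f n x\<bar> powr p \<partial>\<mu>) \<le> (\<integral>x. 2 powr p * (\<bar>f n x - g x\<bar> powr p + \<bar>g x\<bar> powr p) \<partial>\<mu>)"
    proof (rule integral_mono[OF fi])
      show "\<bar>f n x\<bar> powr p \<le> 2 powr p * (\<bar>f n x - g x\<bar> powr p + \<bar>g x\<bar> powr p)" for x
        using assms(1) by (intro order_trans[OF powr_mono2 powr_add_le]) auto
    qed (use di gi in auto)
    then show ?thesis using di gi by (simp add: D_def G_def)
  qed
  have h_near: "\<forall>\<^sub>F n in sequentially. AE x in \<mu>. \<bar>h n x - 1\<bar> \<le> e" if "0 < e" for e
    using uniform_limitD[OF assms(11) that]
  proof eventually_elim
    case (elim n)
    show ?case using supp elim by (auto simp: dist_real_def elim!: eventually_mono dest!: bspec)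
  qed
  \<comment> \<open>Read off from \<open>TLp_dist_density_le\<close> after factoring out
    \<open>e\<close>: the leading 1 absorbs \<open>D n < e\<close>, and
    \<open>2 powr p * (1 + G)\<close> bounds the moment of \<open>f n\<close> since
    \<open>D n < 1\<close>. \<open>C\<close> depends on neither \<open>n\<close> nor
    \<open>e\<close>.\<close>
  define C where "C = 1 + 2 * 2 powr p * (2 * A + 2 powr p * (1 + G) + G)"
  have C0: "0 < C" using nonneg by (auto simp: C_def intro!: add_pos_nonneg mult_nonneg_nonneg add_nonneg_nonneg)
  have bound: "\<forall>\<^sub>F n in sequentially. TLp_dist p (\<mu>t n, f n) (\<mu>, g) \<le> ennreal ((e * C) powr (1 / p))"
    if e: "0 < e" "e \<le> 1" for e
    \<comment> \<open>The same \<open>e\<close> controls both the deviation of \<open>h n\<close>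
      from 1 and \<open>D n\<close>.\<close>
    using h_near[OF e(1)] order_tendstoD(2)[OF Dlim e(1)]
  proof eventually_elim
    case (elim n)
    let ?I = "(\<integral>\<^sup>+x. ennreal (\<bar>f n x - g x\<bar> powr p) \<partial>\<mu>) + ennreal (2 * e * 2 powr p) *
      ((\<integral>\<^sup>+x. ennreal (norm x powr p + \<bar>f n x\<bar> powr p) \<partial>\<mu>) +
       (\<integral>\<^sup>+x. ennreal (norm x powr p + \<bar>g x\<bar> powr p) \<partial>\<mu>))"
    let ?f = "\<integral>x. \<bar>f n x\<bar> powr p \<partial>\<mu>"
    have f0: "0 \<le> ?f" by (intro integral_nonneg_AE) auto
    have "TLp_dist p (\<mu>t n, f n) (\<mu>, g) \<le> ennreal_root p ?I"
      unfolding dens using elim assms(1) e M assms(8)[of n] dens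
      by (intro TLp_dist_density_le) (auto intro: prob_space_axioms)
    also have "\<dots> \<le> ennreal_root p (ennreal (e * C))"
    proof (rule ennreal_root_mono)
      \<comment> \<open>All integrands are integrable, so the estimate can be carried out in the
        reals.\<close>
      have "?I = ennreal (D n + 2 * e * 2 powr p * ((A + ?f) + (A + G)))"
        using fi gi ni di e nonneg f0
        by (simp add: nn_integral_eq_integral D_def A_def G_def ennreal_plus[symmetric] ennreal_mult[symmetric] del: ennreal_plus)
      also have "\<dots> \<le> ennreal (e * C)"
      proof (rule ennreal_leI)
        have "2 powr p * (D n + G) \<le> 2 powr p * (1 + G)"
          using elim(2) e by (intro mult_left_mono) auto
        then have "?f \<le> 2 powr p * (1 + G)" using F[of n] by linarith
        then have "2 * e * 2 powr p * ((A + ?f) + (A + G)) \<le> 2 * e * 2 powr p * (2 * A + 2 powr p * (1 + G) + G)"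
          using e by (intro mult_left_mono) auto
        then show "D n + 2 * e * 2 powr p * ((A + ?f) + (A + G)) \<le> e * C"
          using elim(2) unfolding C_def by (simp add: distrib_left)
      qed
      finally show "?I \<le> ennreal (e * C)" .
    qed (use assms(1) in auto)
    finally show ?case using e C0 by (simp add: ennreal_root_def)
  qed
  have "(\<lambda>n. TLp_dist p (\<mu>t n, f n) (\<mu>, g)) \<longlonglongrightarrow> 0"
  proof (rule order_tendstoI)
    fix a :: ennreal assume "0 < a"
    \<comment> \<open>The bound vanishes as \<open>e\<close> decreases to 0, so \<open>e\<close> can
      be fixed from \<open>a\<close> before \<open>n\<close> is taken large.\<close>
    have "((\<lambda>e. ennreal ((e * C) powr (1 / p))) \<longlongrightarrow> ennreal ((0 * C) powr (1 / p))) (at_right 0)"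
      using assms(1) C0
      by (intro tendsto_ennrealI tendsto_powr' tendsto_intros)
        (auto simp: eventually_at_right_less intro!: eventually_at_right_less[THEN eventually_mono])
    then have "\<forall>\<^sub>F e in at_right 0. ennreal ((e * C) powr (1 / p)) < a"
      using \<open>0 < a\<close> by (intro order_tendstoD(2)) auto
    moreover have "\<forall>\<^sub>F e::real in at_right 0. 0 < e \<and> e < 1"
      using eventually_at_right_real[of 0 1] by simp
    ultimately have "\<forall>\<^sub>F e in at_right 0. 0 < e \<and> e < 1 \<and> ennreal ((e * C) powr (1 / p)) < a"
      by eventually_elim simp
    then obtain e where e: "0 < e" "e < 1" "ennreal ((e * C) powr (1 / p)) < a"
      using eventually_happens'[OF trivial_limit_at_right_real] by blast
    show "\<forall>\<^sub>F n in sequentially. TLp_dist p (\<mu>t n, f n) (\<mu>, g) < a"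
      using bound[of e] e by (auto elim!: eventually_mono)
  qed simp
  moreover have "(\<mu>, g) \<in> TLp_space p K"
    using assms(5,14) M gL by (simp add: TLp_space_def)
  moreover have "\<forall>\<^sub>F n in sequentially. (\<mu>t n, f n) \<in> TLp_space p K"
    \<comment> \<open>Tolerance 1 gives \<open>h n x \<le> 2\<close> almost everywhere, so
      \<open>2 * \<bar>f n x\<bar> powr p\<close> dominates the integrand. Such a bound is available
      only from some index on.\<close>
    using h_near[OF zero_less_one]
  proof eventually_elim
    case (elim n)
    have "integrable \<mu> (\<lambda>x. h n x * \<bar>f n x\<bar> powr p)"
    proof (rule Bochner_Integration.integrable_bound)
      show "integrable \<mu> (\<lambda>x. 2 * \<bar>f n x\<bar> powr p)" using fi by simp
      show "AE x in \<mu>. norm (h n x * \<bar>f n x\<bar> powr p) \<le> norm (2 * \<bar>f n x\<bar> powr p)"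
        using elim by (auto simp: abs_mult elim!: eventually_mono intro!: mult_right_mono)
    qed measurable
    then have "integrable (\<mu>t n) (\<lambda>x. \<bar>f n x\<bar> powr p)"
      unfolding dens using h0 by (subst integrable_density) auto
    moreover have "measure_support (\<mu>t n) \<subseteq> K"
      using measure_support_absolutely_continuous[OF assms(9) M] assms(14) by blast
    moreover have "f n \<in> borel_measurable (\<mu>t n)"
      using f_meas assms(7)[of n] by (simp cong: measurable_cong_sets)
    ultimately show ?case using assms(7,8) by (simp add: TLp_space_def Lp_space_def)
  qed
  ultimately show ?thesis by (simp add: TLp_tendsto_def)
qed

end
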